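(* Let $d\ge3$ be an odd integer, let $\theta_d\in(0,1)$ be the unique non-negative solution of $d\,x^{d-1}+(d-1)x^d-1=0$, and let $\vartheta_d=d\,\theta_d^{\,d-1}$. For a sequence $\bar p=(p_j)_{j\ge1}$ in $(0,1]$ with $p_j<1$ for infinitely many $j$, let $E=E_{\bar p}=\{z\in\mathbb{C}:\limsup_{j\to+\infty}|\tilde f_j(z)|<+\infty\}$. Then the following hold: (i) $E$ is connected if and only if $1-p_1\in E$. (ii) If $p_j\ge\vartheta_d$ for all $j\ge2$, then $E$ is connected. (iii) For every $0<\delta<\vartheta_d$ there exists $k=k(\delta)$ such that if $p_{m+r}<\vartheta_d-\delta$ for some $m\ge2$ and all $0\le r\le k$, then $E$ is not connected. (iv) If $p_j<1/2$ for some $j$, then $E$ has at least $d^j$ connected components. (v) If $p_j<1/2$ for infinitely many $j$, then $E$ has an infinite number of connected components. (vi) If $p_j$ is randomly chosen in such a way that $(p_i)_{i\ge1}$ is a sequence of independent identically distributed random variables with $P(p_i<\vartheta_d)>0$, then $$P\big(E_{\bar p}\text{ has an infinite number of connected components}\big)=1.$$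
   Context: $f_j(z)=\left(\frac{z-(1-p_j)}{p_j}\right)^d$ for $j\ge1$, $z\in\mathbb{C}$, and $\tilde f_j=f_j\circ\cdots\circ f_1$.
   Formalization: In (iv) the bound d^j is replaced by d^{j-1}: as printed (iv) contradicts (ii), e.g. d=3, p_1=1/4, p_j=7/8 for j≥2 gives E connected, while (iv) with j=1 would demand at least 3 components; d^{j-1} is the sharp bound. *)

theory Defs
  imports "HOL-Probability.Probability"
begin

text \<open>Sequences are functions on \<open>nat\<close> of which only the values at indices \<open>\<ge> 1\<close> matter.\<close>

definition fstep :: "nat \<Rightarrow> (nat \<Rightarrow> real) \<Rightarrow> nat \<Rightarrow> complex \<Rightarrow> complex" where
  "fstep d p j z = ((z - of_real (1 - p j)) / of_real (p j)) ^ d"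

text \<open>\<open>ftilde d p j = fstep d p j \<circ> \<dots> \<circ> fstep d p 1\<close>: the map with index 1 is applied first.\<close>

primrec ftilde :: "nat \<Rightarrow> (nat \<Rightarrow> real) \<Rightarrow> nat \<Rightarrow> complex \<Rightarrow> complex" where
  "ftilde d p 0 = id"
| "ftilde d p (Suc j) = fstep d p (Suc j) \<circ> ftilde d p j"

definition Eset :: "nat \<Rightarrow> (nat \<Rightarrow> real) \<Rightarrow> complex set" where
  "Eset d p = {z. limsup (\<lambda>j. ereal (norm (ftilde d p j z))) < \<infinity>}"

definition admissible :: "(nat \<Rightarrow> real) \<Rightarrow> bool" where
  "admissible p \<longleftrightarrow> (\<forall>j\<ge>1. 0 < p j \<and> p j \<le> 1) \<and> infinite {j. 1 \<le> j \<and> p j < 1}"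

definition theta :: "nat \<Rightarrow> real" where
  "theta d = (THE x. 0 \<le> x \<and> real d * x ^ (d - 1) + (real d - 1) * x ^ d - 1 = 0)"

definition vartheta :: "nat \<Rightarrow> real" where
  "vartheta d = real d * theta d ^ (d - 1)"

text \<open>The description in the definition of \<^const>\<open>theta\<close> is proper.\<close>

lemma theta_unique:
  assumes "d \<ge> 2"
  shows "\<exists>!x. 0 \<le> x \<and> real d * x ^ (d - 1) + (real d - 1) * x ^ d - 1 = 0"
    and "0 < theta d" and "theta d < 1"
    and "real d * theta d ^ (d - 1) + (real d - 1) * theta d ^ d - 1 = 0"
proof -
  define g where "g x = real d * x ^ (d - 1) + (real d - 1) * x ^ d - 1" for x :: real
  have mono: "g x < g y" if "0 \<le> x" "x < y" for x y
  proof -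
    have "x ^ (d - 1) < y ^ (d - 1)" "x ^ d \<le> y ^ d"
      using that assms by (auto intro!: power_strict_mono power_mono)
    then have "real d * x ^ (d - 1) < real d * y ^ (d - 1)"
      "(real d - 1) * x ^ d \<le> (real d - 1) * y ^ d"
      using assms by (auto intro!: mult_strict_left_mono mult_left_mono)
    then show ?thesis unfolding g_def by linarith
  qed
  have g0: "g 0 = - 1" and g1: "g 1 > 0"
    using assms by (auto simp: g_def power_0_left)
  have "continuous_on {0..1} g"
    unfolding g_def by (intro continuous_intros)
  then obtain x where x: "0 \<le> x" "x \<le> 1" "g x = 0"
    using IVT'[of g 0 0 1] g0 g1 by force
  have uniq: "y = x" if "0 \<le> y \<and> g y = 0" for y
    using mono[of x y] mono[of y x] that x by (metis less_irrefl linorder_less_linear)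
  have th: "theta d = x"
    unfolding theta_def g_def[symmetric]
    by (rule the_equality) (blast intro: x, blast intro: uniq)
  show "\<exists>!x. 0 \<le> x \<and> real d * x ^ (d - 1) + (real d - 1) * x ^ d - 1 = 0"
    unfolding g_def[symmetric] using x uniq by blast
  have "x \<noteq> 0" "x \<noteq> 1"
    using x(3) g0 g1 by auto
  then show "0 < theta d" "theta d < 1"
    using x th by linarith+
  show "real d * theta d ^ (d - 1) + (real d - 1) * theta d ^ d - 1 = 0"
    using x unfolding th g_def by simp
qed

end

theory Submission
  imports Defs "HOL-Complex_Analysis.Conformal_Mappings"
begin

text \<open>The complement of the unit disc escapes, so \<open>Eset d p\<close> is compact and is the preimage under
  \<open>ftilde d p k\<close> of the set of the shifted sequence. For odd \<open>d\<close> every step is increasing on the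
  real axis and the orbit of \<open>0\<close> stays in \<open>(-\<infinity>, 0]\<close>. Hence if \<open>0\<close> is bounded for the sequence
  shifted by \<open>k\<close>, it is so for all later shifts, and if \<open>0\<close> escapes, the whole ray \<open>(-\<infinity>, 0]\<close> does.
  In the latter case the \<open>d\<close> branches of the root on the slit plane multiply the number of
  components by \<open>d\<close>. In the former, all critical values of the steps are bounded and preimages of
  connected sets stay connected, because each component of the preimage maps onto the whole set.
  So the component count is infinite exactly when \<open>0\<close> escapes for every shift; this is also what
  makes the event in (vi) measurable. Finally \<open>vartheta d\<close> is the minimum of
  \<open>(1 + t ^ d) / (1 + t)\<close>, the threshold at which the real map loses its fixed point.\<close>

section \<open>Components of preimages\<close>

lemma component_preimage_meets_fibre:
  fixes f :: "complex \<Rightarrow> complex"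
  assumes cont: "continuous_on UNIV f"
    and opn: "\<And>U. open U \<Longrightarrow> open (f ` U)"
    and comp: "compact (f -` L)" and conn: "connected L" and c: "c \<in> L"
    and C: "C \<in> components (f -` L)"
  shows "\<exists>z\<in>C. f z = c"
proof (rule ccontr)
  assume "\<not> ?thesis"
  then have sub: "C \<subseteq> - (f -` {c})" by auto
  have "closed (f -` {c})"
    using cont by (intro closed_vimage) auto
  then have U: "open (- (f -` {c}))" by auto
  have "compact C"
    using comp C compact_components by blast
  moreover have "locally compact (f -` L)"
    using comp closed_imp_locally_compact compact_imp_closed by blast
  ultimately obtain K where K: "openin (top_of_set (f -` L)) K" "compact K" "C \<subseteq> K" "K \<subseteq> - (f -` {c})"
    using Sura_Bura_clopen_subset[OF _ C _ U sub] by metis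
  obtain W where W: "open W" "K = f -` L \<inter> W"
    using K(1) by (auto simp: openin_open)
  have "f ` K = L \<inter> f ` W" unfolding W(2) by auto
  then have "openin (top_of_set L) (f ` K)"
    using opn[OF W(1)] by (metis openin_open)
  moreover have "compact (f ` K)"
    using K(2) cont compact_continuous_image continuous_on_subset by blast
  then have "closedin (top_of_set L) (f ` K)"
    using W(2) by (intro closed_subset) (auto intro: compact_imp_closed)
  ultimately have "f ` K = {} \<or> f ` K = L"
    using conn connected_clopen by blast
  moreover have "C \<noteq> {}" using C in_components_nonempty by blast
  ultimately show False using K c by auto
qed

text \<open>All components contain \<open>a\<close>, so they coincide. It is applied to a step map
  with \<open>c = 0\<close>, the critical value, and \<open>a\<close> the critical point.\<close>

lemma connected_preimage_single_fibre:
  fixes f :: "complex \<Rightarrow> complex"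
  assumes "continuous_on UNIV f" "\<And>U. open U \<Longrightarrow> open (f ` U)"
    and "compact (f -` L)" "connected L" "c \<in> L" and single: "f -` {c} = {a}"
  shows "connected (f -` L)"
proof -
  have "a \<in> C" if "C \<in> components (f -` L)" for C
    using component_preimage_meets_fibre[OF assms(1-5) that] single by auto
  then have "C = C'" if "C \<in> components (f -` L)" "C' \<in> components (f -` L)" for C C'
    using that components_eq[of C "f -` L" C'] by blast
  then show ?thesis
    using connected_eq_components_subset_sing_exists[of "f -` L"] by blast
qed

lemma finite_components_preimage:
  fixes f :: "complex \<Rightarrow> complex"
  assumes "continuous_on UNIV f" "\<And>U. open U \<Longrightarrow> open (f ` U)"
    and "compact (f -` L)" "connected L" "c \<in> L" and fin: "finite (f -` {c})"
  shows "finite (components (f -` L))"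
proof -
  obtain g where g: "\<And>C. C \<in> components (f -` L) \<Longrightarrow> g C \<in> C \<and> f (g C) = c"
    using component_preimage_meets_fibre[OF assms(1-5)] by metis
  have "inj_on g (components (f -` L))"
  proof (rule inj_onI)
    fix C C' assume "C \<in> components (f -` L)" "C' \<in> components (f -` L)" "g C = g C'"
    then show "C = C'" using g[of C] g[of C'] components_eq[of C "f -` L" C'] by auto
  qed
  moreover have "g ` components (f -` L) \<subseteq> f -` {c}"
    using g by auto
  ultimately show ?thesis
    using fin by (metis finite_imageD finite_subset)
qed

section \<open>Branches of the \<open>d\<close>-th root and counting components of preimages\<close>

definition root_branch :: "nat \<Rightarrow> complex \<Rightarrow> complex" where
  "root_branch d u = exp (Ln u / of_nat d)"

lemma root_branch_power: "d > 0 \<Longrightarrow> u \<noteq> 0 \<Longrightarrow> root_branch d u ^ d = u"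
  unfolding root_branch_def by (simp flip: exp_of_nat_mult)

lemma root_branch_nonzero [simp]: "root_branch d u \<noteq> 0"
  unfolding root_branch_def by simp

lemma continuous_on_root_branch:
  "d > 0 \<Longrightarrow> K \<inter> \<real>\<^sub>\<le>\<^sub>0 = {} \<Longrightarrow> continuous_on K (root_branch d)"
  unfolding root_branch_def by (auto intro!: continuous_intros)

text \<open>Off the slit the \<open>d\<close>-th root has \<open>d\<close> continuous branches, and the quotient of a preimage
  by the principal branch is a locally constant label telling them apart.\<close>

lemma components_preimage_power_affine:
  fixes a b :: complex and K :: "complex set" and d :: nat
  defines "f \<equiv> \<lambda>z. ((z - a) / b) ^ d"
  assumes d: "d > 0" and b: "b \<noteq> 0" and slit: "K \<inter> \<real>\<^sub>\<le>\<^sub>0 = {}"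
    and fin: "finite (components (f -` K))"
  shows "d * card (components K) \<le> card (components (f -` K))" "finite (components K)"
proof -
  define R where "R = {z::complex. z ^ d = 1}"
  have R: "finite R" "card R = d"
    using d finite_nth_roots[OF d, of 1] card_roots_unity_eq[OF d] by (auto simp: R_def)
  \<comment> \<open>\<open>g r\<close> is the section of \<open>f\<close> belonging to the root of
    unity \<open>r\<close>; \<open>s\<close> recovers that label from a preimage.\<close>
  define g where "g r u = a + b * (r * root_branch d u)" for r u
  define s where "s z = ((z - a) / b) / root_branch d (f z)" for z
  have nz: "u \<noteq> 0" if "u \<in> K" for u using that slit by auto
  have fg: "f (g r u) = u" if "r \<in> R" "u \<in> K" for r u
    using that b nz d by (simp add: f_def g_def R_def power_mult_distrib root_branch_power)
  have sg: "s (g r u) = r" if "r \<in> R" "u \<in> K" for r u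
    using b fg[OF that] by (simp add: s_def) (simp add: g_def)
  have sR: "s z \<in> R" if "z \<in> f -` K" for z
  proof -
    have "s z ^ d = f z / root_branch d (f z) ^ d"
      by (simp only: s_def power_divide) (simp add: f_def power_divide)
    then show ?thesis using that d nz[of "f z"] by (simp add: R_def root_branch_power)
  qed
  have contf: "continuous_on A f" for A
    unfolding f_def using b by (auto intro!: continuous_intros)
  have conts: "continuous_on (f -` K) s"
    unfolding s_def using b contf
    by (auto intro!: continuous_intros continuous_on_compose2[OF continuous_on_root_branch[OF d slit]])
  have contg: "continuous_on K (g r)" for r
    unfolding g_def by (intro continuous_intros continuous_on_root_branch d slit)
  have sconst: "s x = s y" if "X \<in> components (f -` K)" "x \<in> X" "y \<in> X" for X x y
  proof -
    have X: "connected X" "X \<subseteq> f -` K"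
      using in_components_connected[OF that(1)] in_components_subset[OF that(1)] by simp_all
    then have "s ` X \<subseteq> R" using sR by blast
    then have "s constant_on X"
      using X R conts by (intro continuous_finite_range_constant)
        (auto intro: continuous_on_subset finite_subset)
    then show ?thesis using that unfolding constant_on_def by metis
  qed
  have ex: "\<exists>X\<in>components (f -` K). g r ` C \<subseteq> X" if "r \<in> R" "C \<in> components K" for r C
  proof -
    have C: "connected C" "C \<subseteq> K" "C \<noteq> {}"
      using in_components_connected[OF that(2)] in_components_subset[OF that(2)]
        in_components_nonempty[OF that(2)] by simp_all
    have "connected (g r ` C)"
      using C contg by (meson connected_continuous_image continuous_on_subset)
    moreover have "g r ` C \<subseteq> f -` K" using fg that C by auto
    moreover have "f -` K \<noteq> {}" using fg that C by blast
    ultimately show ?thesis using exists_component_superset by metis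
  qed
  \<comment> \<open>\<open>H\<close> sends a branch and a component of \<open>K\<close> to the
    component containing the lift. It is injective: the constant label gives back \<open>r\<close>,
    and the connected image under \<open>f\<close> gives back \<open>C\<close>.\<close>
  define H where "H = (\<lambda>(r, C). SOME X. X \<in> components (f -` K) \<and> g r ` C \<subseteq> X)"
  have H: "H (r, C) \<in> components (f -` K) \<and> g r ` C \<subseteq> H (r, C)"
    if "r \<in> R" "C \<in> components K" for r C
    unfolding H_def prod.case by (rule someI_ex) (use ex[OF that] in blast)
  have "inj_on H (R \<times> components K)"
  proof (rule inj_onI, clarify)
    fix r C r' C' assume *: "r \<in> R" "C \<in> components K" "r' \<in> R" "C' \<in> components K"
      "H (r, C) = H (r', C')"
    obtain u u' where u: "u \<in> C" "u' \<in> C'" "u \<in> K" "u' \<in> K"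
      using * in_components_nonempty in_components_subset by (metis subset_eq ex_in_conv)
    define X where "X = H (r, C)"
    have X: "X \<in> components (f -` K)" "g r u \<in> X" "g r' u' \<in> X"
      using H[OF *(1,2)] H[OF *(3,4)] u *(5) unfolding X_def by auto
    have "r = r'" using sconst[OF X] sg u * by simp
    have "connected (f ` X)"
      using X(1) contf connected_continuous_image in_components_connected by blast
    moreover have "f ` X \<subseteq> K" using in_components_subset[OF X(1)] by auto
    moreover have "u \<in> f ` X" "u' \<in> f ` X"
      using X fg[OF *(1) u(3)] fg[OF *(3) u(4)] by force+
    ultimately have "u' \<in> C"
      using components_maximal[OF *(2), of "f ` X"] u by blast
    then have "C = C'" using components_eq[OF *(2,4)] u by blast
    with \<open>r = r'\<close> show "r = r' \<and> C = C'" by simp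
  qed
  moreover have sub: "H ` (R \<times> components K) \<subseteq> components (f -` K)"
    using H by auto
  ultimately have "finite (R \<times> components K)"
    using fin by (metis finite_imageD finite_subset)
  moreover have "R \<noteq> {}" using R d by auto
  ultimately show "finite (components K)" by (auto simp: finite_cartesian_product_iff)
  have "card (R \<times> components K) \<le> card (components (f -` K))"
    using card_inj_on_le[OF \<open>inj_on H _\<close> sub fin] .
  then show "d * card (components K) \<le> card (components (f -` K))"
    using R by (simp add: card_cartesian_product)
qed

section \<open>Nonautonomous filled Julia sets\<close>

definition unit_params :: "(nat \<Rightarrow> real) \<Rightarrow> bool" where
  "unit_params p \<longleftrightarrow> (\<forall>j\<ge>1. 0 < p j \<and> p j \<le> 1)"

definition param_shift :: "nat \<Rightarrow> (nat \<Rightarrow> real) \<Rightarrow> nat \<Rightarrow> real" where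
  "param_shift k p i = p (i + k)"

lemma admissible_unit_params: "admissible p \<Longrightarrow> unit_params p"
  by (simp add: admissible_def unit_params_def)

lemma unit_params_shift: "unit_params p \<Longrightarrow> unit_params (param_shift k p)"
  by (simp add: unit_params_def param_shift_def)

lemma unit_paramsD: "unit_params p \<Longrightarrow> j \<ge> 1 \<Longrightarrow> 0 < p j \<and> p j \<le> 1"
  by (simp add: unit_params_def)

lemma param_shift_0 [simp]: "param_shift 0 p = p"
  and param_shift_param_shift [simp]: "param_shift k (param_shift l p) = param_shift (k + l) p"
  by (auto simp: param_shift_def add_ac)

lemma ftilde_add: "ftilde d p (j + k) z = ftilde d (param_shift k p) j (ftilde d p k z)"
  by (induction j) (auto simp: fstep_def param_shift_def)

lemma ftilde_Suc_shift: "ftilde d p (Suc j) z = ftilde d (param_shift 1 p) j (fstep d p 1 z)"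
  using ftilde_add[of d p j 1 z] by simp

text \<open>Outside the open unit disc the affine part, an expansion about its fixed point 1, does
  not decrease the norm: this amounts to \<open>(norm z - 1) * (1 - p j) \<ge> 0\<close>.\<close>

lemma norm_fstep_ge:
  assumes "0 < p j" "p j \<le> 1" "norm z \<ge> 1"
  shows "norm (fstep d p j z) \<ge> norm z ^ d"
proof -
  have "norm z - (1 - p j) \<le> norm (z - of_real (1 - p j))"
    using norm_triangle_ineq2[of z "of_real (1 - p j)"] assms by (simp only: norm_of_real)
  moreover have "norm z * p j \<le> norm z - (1 - p j)"
    using assms mult_nonneg_nonneg[of "norm z - 1" "1 - p j"] by (simp add: algebra_simps)
  ultimately have "norm z \<le> norm ((z - of_real (1 - p j)) / of_real (p j))"
    using assms by (simp add: norm_divide pos_le_divide_eq del: of_real_diff)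
  then show ?thesis unfolding fstep_def norm_power by (intro power_mono) auto
qed

lemma norm_ftilde_ge:
  assumes "unit_params p" "norm z \<ge> 1"
  shows "norm (ftilde d p j z) \<ge> norm z ^ (d ^ j)"
proof (induction j)
  case (Suc j)
  have "1 \<le> norm z ^ (d ^ j)" using assms by simp
  then have "norm (ftilde d p (Suc j) z) \<ge> norm (ftilde d p j z) ^ d"
    using Suc unit_paramsD[OF assms(1), of "Suc j"] norm_fstep_ge[of p "Suc j" "ftilde d p j z"] by auto
  moreover have "norm (ftilde d p j z) ^ d \<ge> (norm z ^ (d ^ j)) ^ d"
    using Suc by (intro power_mono) auto
  ultimately show ?case by (simp add: power_mult[symmetric] mult.commute)
qed auto

lemma Eset_shift:
  shows "z \<in> Eset d p \<longleftrightarrow> ftilde d p k z \<in> Eset d (param_shift k p)"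
  unfolding Eset_def using limsup_shift_k[of "\<lambda>j. ereal (norm (ftilde d p j z))" k]
  by (simp add: ftilde_add)

lemma Eset_vimage: "Eset d p = ftilde d p k -` Eset d (param_shift k p)"
  using Eset_shift by auto

lemma Eset_vimage_fstep: "Eset d p = fstep d p 1 -` Eset d (param_shift 1 p)"
  using Eset_vimage[of d p 1] by simp

lemma Eset_subset_cball:
  assumes "unit_params p" "d \<ge> 2" "z \<in> Eset d p"
  shows "norm z \<le> 1"
proof (rule ccontr)
  assume "\<not> norm z \<le> 1"
  then have z: "norm z > 1" by simp
  have "filterlim (\<lambda>j. norm (ftilde d p j z)) at_top sequentially"
  proof (rule filterlim_at_top_mono)
    show "filterlim (\<lambda>j. norm z ^ j) at_top sequentially"
      using z filterlim_realpow_sequentially_gt1[of "norm z"]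
      by (intro filterlim_at_infinity_imp_filterlim_at_top) (auto intro!: always_eventually zero_less_power intro: less_trans[OF zero_less_one])
    show "\<forall>\<^sub>F j in sequentially. norm z ^ j \<le> norm (ftilde d p j z)"
    proof (rule always_eventually, rule allI)
      fix j
      have "j \<le> d ^ j" using assms(2) less_exp[of j] power_mono[of 2 d j] by linarith
      then have "norm z ^ j \<le> norm z ^ (d ^ j)" using z by (intro power_increasing) auto
      then show "norm z ^ j \<le> norm (ftilde d p j z)"
        using norm_ftilde_ge[OF assms(1), of z d j] z by linarith
    qed
  qed
  then have "(\<lambda>j. ereal (norm (ftilde d p j z))) \<longlonglongrightarrow> \<infinity>"
    by (simp add: tendsto_PInfty_eq_at_top)
  then have "limsup (\<lambda>j. ereal (norm (ftilde d p j z))) = \<infinity>"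
    by (intro lim_imp_Limsup) auto
  then show False using assms(3) by (simp add: Eset_def)
qed

text \<open>Leaving the closed unit disc once already means escaping, so the limsup condition
  becomes a countable family of closed conditions. Compactness and, later, measurability rest on
  this form.\<close>

lemma Eset_iff:
  assumes "unit_params p" "d \<ge> 2"
  shows "z \<in> Eset d p \<longleftrightarrow> (\<forall>j. norm (ftilde d p j z) \<le> 1)"
proof
  assume "z \<in> Eset d p"
  then show "\<forall>j. norm (ftilde d p j z) \<le> 1"
    using Eset_shift Eset_subset_cball[OF unit_params_shift[OF assms(1)] assms(2)] by blast
next
  assume "\<forall>j. norm (ftilde d p j z) \<le> 1"
  then have "limsup (\<lambda>j. ereal (norm (ftilde d p j z))) \<le> 1"
    by (intro Limsup_bounded always_eventually) (auto simp: one_ereal_def)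
  then show "z \<in> Eset d p" unfolding Eset_def by auto
qed

lemma norm_ftilde_le_1_antimono:
  assumes "unit_params p" "d > 0" "i \<le> j" "norm (ftilde d p j z) \<le> 1"
  shows "norm (ftilde d p i z) \<le> 1"
proof (rule ccontr)
  assume "\<not> ?thesis"
  then have *: "norm (ftilde d p i z) > 1" by simp
  obtain m where m: "j = m + i" using assms(3) by (metis add.commute le_iff_add)
  have "norm (ftilde d p i z) ^ (d ^ m) \<le> norm (ftilde d p j z)"
    unfolding m ftilde_add using * by (intro norm_ftilde_ge unit_params_shift assms) auto
  moreover have "1 < norm (ftilde d p i z) ^ (d ^ m)"
    using * assms(2) by (intro one_less_power) auto
  ultimately show False using assms(4) by simp
qed

section \<open>Continuity, openness and finite fibres of the maps\<close>

lemma continuous_on_fstep: "0 < p j \<Longrightarrow> continuous_on A (fstep d p j)"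
  unfolding fstep_def by (auto intro!: continuous_intros)

lemma open_fstep_image:
  assumes "0 < p j" "d > 0" "open U"
  shows "open (fstep d p j ` U)"
proof (rule open_mapping_thm[where S = UNIV])
  show "fstep d p j holomorphic_on UNIV"
    unfolding fstep_def using assms by (auto intro!: holomorphic_intros)
  show "\<not> fstep d p j constant_on UNIV"
  proof
    assume "fstep d p j constant_on UNIV"
    \<comment> \<open>The point 1 is fixed, whereas the critical point \<open>1 - p j\<close> goes
      to 0.\<close>
    then have "fstep d p j 1 = fstep d p j (of_real (1 - p j))"
      unfolding constant_on_def by auto
    then show False using assms by (simp add: fstep_def power_0_left)
  qed
qed (use assms in auto)

lemma continuous_on_ftilde: "unit_params p \<Longrightarrow> continuous_on A (ftilde d p j)"
proof (induction j)
  case (Suc j)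
  then show ?case
    using unit_paramsD[OF Suc.prems, of "Suc j"]
    by (simp only: ftilde.simps) (auto intro!: continuous_on_compose continuous_on_fstep simp del: o_apply)
qed (auto intro: continuous_on_id simp: id_def)

lemma open_ftilde_image:
  "unit_params p \<Longrightarrow> d > 0 \<Longrightarrow> open U \<Longrightarrow> open (ftilde d p j ` U)"
proof (induction j)
  case (Suc j)
  then show ?case
    using unit_paramsD[OF Suc.prems(1), of "Suc j"]
    by (simp only: ftilde.simps image_comp[symmetric]) (auto intro: open_fstep_image)
qed simp

lemma finite_ftilde_fibre:
  assumes "unit_params p" "d > 0"
  shows "finite (ftilde d p j -` {c})"
proof (induction j arbitrary: c)
  case (Suc j)
  have pos: "p (Suc j) > 0" using unit_paramsD[OF assms(1), of "Suc j"] by simp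
  define h where "h z = (z - of_real (1 - p (Suc j))) / of_real (p (Suc j))" for z :: complex
  have "inj h" using pos by (auto simp: h_def intro!: injI)
  then have fin: "finite (h -` {w. w ^ d = c})"
    using finite_nth_roots[OF assms(2), of c] by (intro finite_vimageI)
  have "ftilde d p (Suc j) -` {c} = (\<Union>w\<in>h -` {w. w ^ d = c}. ftilde d p j -` {w})"
    by (auto simp: fstep_def h_def)
  then show ?case using fin Suc by (simp del: ftilde.simps)
qed simp

section \<open>Connectedness through nested compact level sets\<close>

definition level_set :: "nat \<Rightarrow> (nat \<Rightarrow> real) \<Rightarrow> nat \<Rightarrow> complex set" where
  "level_set d p j = ftilde d p j -` cball 0 1"

lemma level_set_iff: "z \<in> level_set d p j \<longleftrightarrow> norm (ftilde d p j z) \<le> 1"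
  by (simp add: level_set_def dist_norm)

lemma level_set_antimono:
  assumes "unit_params p" "d > 0" "i \<le> j"
  shows "level_set d p j \<subseteq> level_set d p i"
  using norm_ftilde_le_1_antimono[OF assms] by (auto simp: level_set_iff)

lemma compact_level_set:
  assumes "unit_params p" "d > 0"
  shows "compact (level_set d p j)"
proof -
  have "closed (level_set d p j)"
    unfolding level_set_def by (intro closed_vimage continuous_on_ftilde assms) auto
  moreover have "level_set d p j \<subseteq> cball 0 1"
    using level_set_antimono[OF assms, of 0 j] by (auto simp: level_set_iff)
  ultimately show ?thesis
    by (meson bounded_cball bounded_subset compact_eq_bounded_closed)
qed

text \<open>Splitting off the first map, not the last, allows an induction that pulls back along a
  single step while the sequence is shifted.\<close>

lemma level_set_Suc: "level_set d p (Suc j) = fstep d p 1 -` level_set d (param_shift 1 p) j"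
  by (auto simp: level_set_iff ftilde_Suc_shift simp del: ftilde.simps)

lemma Eset_eq_Inter_level_set:
  assumes "unit_params p" "d \<ge> 2"
  shows "Eset d p = (\<Inter>j. level_set d p j)"
  using Eset_iff[OF assms] by (auto simp: level_set_iff)

lemma compact_Eset:
  assumes "unit_params p" "d \<ge> 2"
  shows "compact (Eset d p)"
  unfolding Eset_eq_Inter_level_set[OF assms] using compact_level_set assms
  by (intro compact_Inter) auto

text \<open>Each pullback is along a step whose only critical value 0 lies in the connected set
  pulled back, so the single-fibre criterion applies.\<close>

lemma connected_level_set:
  assumes "unit_params p" "d \<ge> 2" "\<And>k. k \<ge> 1 \<Longrightarrow> 0 \<in> Eset d (param_shift k p)"
  shows "connected (level_set d p j)"
  using assms(1,3)
proof (induction j arbitrary: p)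
  case 0
  then show ?case by (simp add: level_set_def)
next
  case (Suc j)
  have p1: "p 1 > 0" using unit_paramsD[OF Suc.prems(1), of 1] by simp
  have "connected (level_set d (param_shift 1 p) j)"
    by (rule Suc.IH) (use Suc.prems in \<open>auto intro: unit_params_shift\<close>)
  moreover have "compact (fstep d p 1 -` level_set d (param_shift 1 p) j)"
    using compact_level_set[OF Suc.prems(1), of d "Suc j"] assms(2) by (simp add: level_set_Suc)
  moreover have "0 \<in> level_set d (param_shift 1 p) j"
    using Suc.prems(2)[of 1] Eset_eq_Inter_level_set[OF unit_params_shift[OF Suc.prems(1)] assms(2)]
    by auto
  moreover have "fstep d p 1 -` {0} = {of_real (1 - p 1)}"
    using p1 assms(2) by (auto simp: fstep_def)
  ultimately show ?case
    unfolding level_set_Suc using p1 assms(2)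
    by (intro connected_preimage_single_fibre continuous_on_fstep open_fstep_image) auto
qed

lemma connected_Eset:
  assumes "unit_params p" "d \<ge> 2" "\<And>k. k \<ge> 1 \<Longrightarrow> 0 \<in> Eset d (param_shift k p)"
  shows "connected (Eset d p)"
  unfolding Eset_eq_Inter_level_set[OF assms(1,2)]
  by (intro connected_nest compact_level_set connected_level_set level_set_antimono)
    (use assms in auto)

text \<open>The point 1 is fixed by every step. It shows nonemptiness and serves as base point for
  counting fibres.\<close>

lemma one_in_Eset:
  assumes "unit_params p" "d \<ge> 2"
  shows "1 \<in> Eset d p"
proof -
  have "ftilde d p j 1 = 1" for j
  proof (induction j)
    case (Suc j)
    then show ?case using unit_paramsD[OF assms(1), of "Suc j"] by (simp add: fstep_def)
  qed simp
  then show ?thesis using Eset_iff[OF assms] by simp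
qed

section \<open>The orbit of zero\<close>

text \<open>The restriction of \<open>ftilde\<close> to the real axis, kept real-valued so that
  order and Borel measurability can be used.\<close>

primrec real_orbit :: "nat \<Rightarrow> (nat \<Rightarrow> real) \<Rightarrow> nat \<Rightarrow> real \<Rightarrow> real" where
  "real_orbit d p 0 x = x"
| "real_orbit d p (Suc j) x = ((real_orbit d p j x - (1 - p (Suc j))) / p (Suc j)) ^ d"

lemma ftilde_of_real: "ftilde d p j (of_real x) = of_real (real_orbit d p j x)"
  by (induction j) (auto simp: fstep_def)

text \<open>With \<open>y\<close> the negated orbit value, the step reads
  \<open>y \<mapsto> ((1 + y) / p - 1) ^ d\<close>; the threshold is studied in this form.\<close>

lemma real_orbit_Suc_neg:
  assumes "odd d" "p (Suc j) \<noteq> 0"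
  shows "- real_orbit d p (Suc j) x = ((1 - real_orbit d p j x) / p (Suc j) - 1) ^ d"
proof -
  define w where "w = (1 - real_orbit d p j x) / p (Suc j) - 1"
  have "(real_orbit d p j x - (1 - p (Suc j))) / p (Suc j) = - w"
    using assms(2) by (simp add: w_def field_simps)
  then show ?thesis using assms(1) unfolding w_def[symmetric] by (simp add: power_minus_odd)
qed

lemma real_orbit_mono:
  assumes "unit_params p" "odd d" "x \<le> y"
  shows "real_orbit d p j x \<le> real_orbit d p j y"
proof (induction j)
  case (Suc j)
  then show ?case
    using unit_paramsD[OF assms(1), of "Suc j"] assms(2)
    by (auto intro!: power_mono_odd divide_right_mono)
qed (use assms in auto)

lemma real_orbit_nonpos:
  assumes "unit_params p" "odd d" "x \<le> 0"
  shows "real_orbit d p j x \<le> 0"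
proof (induction j)
  case (Suc j)
  then show ?case
    using unit_paramsD[OF assms(1), of "Suc j"] assms(2)
    by (auto simp: power_le_zero_eq divide_le_0_iff odd_pos)
qed (use assms in auto)

lemma nonpos_in_Eset_iff:
  assumes "unit_params p" "d \<ge> 2" "odd d" "x \<le> 0"
  shows "of_real x \<in> Eset d p \<longleftrightarrow> (\<forall>j. real_orbit d p j x \<ge> -1)"
proof -
  have "norm (ftilde d p j (of_real x)) \<le> 1 \<longleftrightarrow> real_orbit d p j x \<ge> -1" for j
    using real_orbit_nonpos[OF assms(1,3,4), of j] unfolding ftilde_of_real norm_of_real by linarith
  then show ?thesis by (simp add: Eset_iff[OF assms(1,2)])
qed

text \<open>By monotonicity the orbit of 0 stays above that of \<open>x\<close>, so it cannot pass
  below -1 first.\<close>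

lemma zero_in_Eset_if_nonpos:
  assumes "unit_params p" "d \<ge> 2" "odd d" "x \<le> 0" "of_real x \<in> Eset d p"
  shows "0 \<in> Eset d p"
proof -
  have "real_orbit d p j 0 \<ge> -1" for j
    using assms real_orbit_mono[OF assms(1,3,4), of j] nonpos_in_Eset_iff[of p d x]
    by (meson order_trans)
  then show ?thesis
    using nonpos_in_Eset_iff[OF assms(1-3), of 0] by simp
qed

lemma Eset_disjoint_slit:
  assumes "unit_params p" "d \<ge> 2" "odd d" "0 \<notin> Eset d p"
  shows "Eset d p \<inter> \<real>\<^sub>\<le>\<^sub>0 = {}"
  using zero_in_Eset_if_nonpos[OF assms(1-3)] assms(4) unfolding nonpos_Reals_def by auto

text \<open>After \<open>k\<close> steps the orbit of 0 is at a nonpositive point that is bounded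
  for the shifted sequence; hence 0 is bounded for it too.\<close>

lemma zero_in_Eset_shift:
  assumes "unit_params p" "d \<ge> 2" "odd d" "0 \<in> Eset d p"
  shows "0 \<in> Eset d (param_shift k p)"
proof -
  have "of_real (real_orbit d p k 0) \<in> Eset d (param_shift k p)"
    using assms(4) Eset_shift[of 0 d p k] ftilde_of_real[of d p k 0] by simp
  then show ?thesis
    using zero_in_Eset_if_nonpos unit_params_shift real_orbit_nonpos assms by blast
qed

lemma zero_in_Eset_shift_mono:
  assumes "unit_params p" "d \<ge> 2" "odd d" "k \<le> l" "0 \<in> Eset d (param_shift k p)"
  shows "0 \<in> Eset d (param_shift l p)"
  using zero_in_Eset_shift[OF unit_params_shift[OF assms(1)] assms(2,3,5), of "l - k"] assms(4) by simp

section \<open>Counting the components of \<open>Eset d p\<close>\<close>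

lemma connected_Eset_if_zero:
  assumes "unit_params p" "d \<ge> 2" "odd d" "0 \<in> Eset d (param_shift 1 p)"
  shows "connected (Eset d p)"
  by (rule connected_Eset[OF assms(1,2) zero_in_Eset_shift_mono[OF assms(1-3) _ assms(4)]])

text \<open>Boundedness of 0 for shift \<open>k\<close> makes the set of shift \<open>k - 1\<close>
  connected. \<open>Eset d p\<close> is its preimage under \<open>k - 1\<close> steps, so the finite
  fibre over 1 bounds the number of components.\<close>

lemma finite_components_Eset:
  assumes "unit_params p" "d \<ge> 2" "odd d" "k \<ge> 1" "0 \<in> Eset d (param_shift k p)"
  shows "finite (components (Eset d p))"
proof -
  have p': "unit_params (param_shift (k - 1) p)" by (rule unit_params_shift) fact
  have "connected (Eset d (param_shift (k - 1) p))"
    using connected_Eset_if_zero[OF p' assms(2,3)] assms(4,5) by simp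
  moreover have "compact (ftilde d p (k - 1) -` Eset d (param_shift (k - 1) p))"
    using compact_Eset[OF assms(1,2)] Eset_vimage[of d p "k - 1"] by simp
  ultimately show ?thesis
    unfolding Eset_vimage[of d p "k - 1"] using assms one_in_Eset[OF p' assms(2)]
    by (intro finite_components_preimage[where c = 1] continuous_on_ftilde open_ftilde_image
        finite_ftilde_fibre) auto
qed

text \<open>Each step over a set avoiding the slit contributes a factor \<open>d\<close>. Finiteness
  is assumed because \<open>card\<close> of an infinite set is 0.\<close>

lemma components_Eset_lower_bound:
  assumes "unit_params p" "d \<ge> 2" "odd d"
    and "\<And>i. 1 \<le> i \<Longrightarrow> i \<le> k \<Longrightarrow> 0 \<notin> Eset d (param_shift i p)"
    and "finite (components (Eset d p))"
  shows "d ^ k \<le> card (components (Eset d p))"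
  using assms(1,4,5)
proof (induction k arbitrary: p)
  case 0
  then have "components (Eset d p) \<noteq> {}" using one_in_Eset[OF _ assms(2)] by fastforce
  then show ?case using 0 by (simp add: Suc_le_eq card_gt_0_iff)
next
  case (Suc k)
  have p': "unit_params (param_shift 1 p)" by (rule unit_params_shift) fact
  have p1: "p 1 > 0" using unit_paramsD[OF Suc.prems(1), of 1] by simp
  have slit: "Eset d (param_shift 1 p) \<inter> \<real>\<^sub>\<le>\<^sub>0 = {}"
    using Suc.prems(2)[of 1] by (intro Eset_disjoint_slit p' assms) auto
  have eq: "Eset d p = (\<lambda>z. ((z - of_real (1 - p 1)) / of_real (p 1)) ^ d) -` Eset d (param_shift 1 p)"
    using Eset_vimage_fstep[of d p] unfolding fstep_def .
  note * = components_preimage_power_affine[OF _ _ slit, of d "of_real (p 1)" "of_real (1 - p 1)",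
      folded eq]
  have "finite (components (Eset d (param_shift 1 p)))"
    using *(2) Suc.prems(3) assms(2) p1 by simp
  moreover have "0 \<notin> Eset d (param_shift i (param_shift 1 p))" if "1 \<le> i" "i \<le> k" for i
    using Suc.prems(2)[of "i + 1"] that by simp
  ultimately have "d ^ k \<le> card (components (Eset d (param_shift 1 p)))"
    using Suc.IH[OF p'] by blast
  then have "d ^ Suc k \<le> d * card (components (Eset d (param_shift 1 p)))" by simp
  also have "\<dots> \<le> card (components (Eset d p))"
    using *(1) Suc.prems(3) assms(2) p1 by simp
  finally show ?case .
qed

lemma infinite_components_Eset_iff:
  assumes "unit_params p" "d \<ge> 2" "odd d"
  shows "infinite (components (Eset d p)) \<longleftrightarrow> (\<forall>k\<ge>1. 0 \<notin> Eset d (param_shift k p))"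
proof (intro iffI allI impI)
  fix k :: nat assume "infinite (components (Eset d p))" "k \<ge> 1"
  then show "0 \<notin> Eset d (param_shift k p)" using finite_components_Eset[OF assms, of k] by auto
next
  assume *: "\<forall>k\<ge>1. 0 \<notin> Eset d (param_shift k p)"
  show "infinite (components (Eset d p))"
  proof
    assume fin: "finite (components (Eset d p))"
    define n where "n = card (components (Eset d p))"
    \<comment> \<open>The lower bound is applied with the supposed number of components as
      exponent.\<close>
    have "d ^ n \<le> n"
      unfolding n_def by (intro components_Eset_lower_bound[OF assms _ fin]) (use * in auto)
    moreover have "n < d ^ n" using assms(2) less_exp[of n] power_mono[of 2 d n] by linarith
    ultimately show False by simp
  qed
qed

lemma connected_Eset_iff:
  assumes "unit_params p" "d \<ge> 2" "odd d"
  shows "connected (Eset d p) \<longleftrightarrow> 0 \<in> Eset d (param_shift 1 p)"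
proof
  assume conn: "connected (Eset d p)"
  show "0 \<in> Eset d (param_shift 1 p)"
  proof (rule ccontr)
    assume "0 \<notin> Eset d (param_shift 1 p)"
    then have *: "0 \<notin> Eset d (param_shift i p)" if "1 \<le> i" "i \<le> 1" for i
      using that by (cases "i = 1") auto
    have "components (Eset d p) = {Eset d p}"
      using conn one_in_Eset[OF assms(1,2)] components_eq_sing_iff by blast
    then show False
      using components_Eset_lower_bound[where k = 1, OF assms *] assms(2) by simp
  qed
qed (rule connected_Eset_if_zero[OF assms])

text \<open>The first step already sends 0 to \<open>-((1 / p 1 - 1) ^ d)\<close>, which is less
  than -1.\<close>

lemma zero_notin_Eset_if_lt_half:
  assumes "unit_params p" "d \<ge> 2" "odd d" "p 1 < 1 / 2"
  shows "0 \<notin> Eset d p"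
proof
  assume "0 \<in> Eset d p"
  then have "real_orbit d p 1 0 \<ge> -1"
    using nonpos_in_Eset_iff[OF assms(1-3), of 0] by (simp del: real_orbit.simps)
  moreover have "1 / p 1 - 1 > 1" "p 1 \<noteq> 0"
    using assms(4) unit_paramsD[OF assms(1), of 1] by (auto simp: less_divide_eq)
  then have "(1 / p 1 - 1) ^ d > 1" using assms(2) by (intro one_less_power) auto
  then have "- real_orbit d p (Suc 0) 0 > 1"
    using real_orbit_Suc_neg[OF assms(3), of p 0 0] \<open>p 1 \<noteq> 0\<close> by simp
  ultimately show False by (simp del: real_orbit.simps)
qed

lemma zero_notin_Eset_shift_if_lt_half:
  assumes "unit_params p" "d \<ge> 2" "odd d" "p j < 1 / 2" "i < j"
  shows "0 \<notin> Eset d (param_shift i p)"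
proof -
  have "param_shift (j - 1) p 1 < 1 / 2" using assms(4,5) by (simp add: param_shift_def)
  then have "0 \<notin> Eset d (param_shift (j - 1) p)"
    by (intro zero_notin_Eset_if_lt_half unit_params_shift assms)
  moreover have "i \<le> j - 1" using assms(5) by simp
  ultimately show ?thesis
    using zero_in_Eset_shift_mono[OF assms(1-3)] by metis
qed

section \<open>The threshold\<close>

text \<open>The last equation restates the definition of \<open>theta d\<close> as the equality case
  of the tangent estimate below.\<close>

lemma theta_facts:
  assumes "d \<ge> 2"
  shows "0 < theta d" "vartheta d > 0" "1 + theta d ^ d = vartheta d * (1 + theta d)"
proof -
  show "0 < theta d" by (rule theta_unique(2)) fact
  then show "vartheta d > 0" unfolding vartheta_def using assms by simp
  have "theta d ^ d = theta d * theta d ^ (d - 1)"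
    using assms by (metis Suc_diff_1 Suc_leD Suc_le_lessD numeral_2_eq_2 power_Suc)
  then show "1 + theta d ^ d = vartheta d * (1 + theta d)"
    using theta_unique(4)[OF assms] unfolding vartheta_def by (simp add: algebra_simps)
qed

text \<open>The tangent to \<open>t ^ d\<close> at \<open>theta d\<close> passes through \<open>(-1, -1)\<close>; its slope is \<open>vartheta d\<close>.\<close>

lemma one_plus_power_ge:
  assumes "d \<ge> 2" "t \<ge> 0"
  shows "1 + t ^ d \<ge> vartheta d * (1 + t)"
proof -
  note th = theta_facts[OF assms(1)]
  \<comment> \<open>Bernoulli's inequality is the tangent line bound for the convex power, rescaled
    so that the point of contact is 1.\<close>
  have "(t / theta d) ^ d \<ge> 1 + real d * (t / theta d - 1)"
    using Bernoulli_inequality[of "t / theta d - 1" d] assms(2) th by simp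
  then have "theta d ^ d * (t / theta d) ^ d \<ge> theta d ^ d * (1 + real d * (t / theta d - 1))"
    using th by (intro mult_left_mono) auto
  moreover have "theta d ^ d * (t / theta d) ^ d = t ^ d"
    using th by (simp add: power_divide)
  moreover have "theta d ^ d = theta d * theta d ^ (d - 1)"
    using assms by (metis Suc_diff_1 Suc_leD Suc_le_lessD numeral_2_eq_2 power_Suc)
  then have "theta d ^ d * (1 + real d * (t / theta d - 1)) = theta d ^ d + vartheta d * (t - theta d)"
    using th unfolding vartheta_def by (simp add: field_simps)
  ultimately show ?thesis using th(3) by (simp add: algebra_simps)
qed

text \<open>The negated orbit is trapped in \<open>[0, theta d ^ d]\<close>: the right end is fixed
  for the parameter \<open>vartheta d\<close>, and larger parameters give smaller values.\<close>

lemma zero_in_Eset_if_ge_vartheta: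
  assumes "unit_params p" "d \<ge> 2" "odd d" "\<And>j. j \<ge> 1 \<Longrightarrow> p j \<ge> vartheta d"
  shows "0 \<in> Eset d p"
proof -
  note th = theta_facts[OF assms(2)]
  have "theta d < 1" by (rule theta_unique(3)) fact
  have bound: "- real_orbit d p j 0 \<le> theta d ^ d" for j
  proof (induction j)
    case (Suc j)
    define y where "y = - real_orbit d p j 0"
    have pj: "0 < p (Suc j)" "p (Suc j) \<le> 1" "vartheta d \<le> p (Suc j)"
      using unit_paramsD[OF assms(1), of "Suc j"] assms(4)[of "Suc j"] by auto
    have y: "0 \<le> y" "y \<le> theta d ^ d"
      using Suc real_orbit_nonpos[OF assms(1,3), of 0 j] by (auto simp: y_def)
    have "(1 + y) / p (Suc j) \<le> (1 + theta d ^ d) / vartheta d"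
      using y pj th by (intro frac_le) auto
    also have "\<dots> = 1 + theta d" using th by simp
    finally have "(1 + y) / p (Suc j) - 1 \<le> theta d" by simp
    moreover have "0 \<le> (1 + y) / p (Suc j) - 1" using y pj by (simp add: field_simps)
    ultimately have "((1 + y) / p (Suc j) - 1) ^ d \<le> theta d ^ d" by (intro power_mono)
    then show ?case
      using real_orbit_Suc_neg[OF assms(3), of p j 0] pj by (simp add: y_def)
  qed (use th in auto)
  have "theta d ^ d \<le> 1" using th \<open>theta d < 1\<close> by (intro power_le_one) auto
  then have "real_orbit d p j 0 \<ge> -1" for j using bound[of j] by linarith
  then show ?thesis using nonpos_in_Eset_iff[OF assms(1-3), of 0] by simp
qed

text \<open>Writing \<open>y = t ^ d\<close>, the tangent estimate shows that the step with
  parameter \<open>q\<close> strictly exceeds \<open>y\<close>. Compactness of \<open>[0, 1]\<close>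
  makes the gain uniform.\<close>

lemma escape_step:
  assumes "d \<ge> 2" "0 < q" "q < vartheta d"
  obtains e :: real where "e > 0" "\<And>y. 0 \<le> y \<Longrightarrow> y \<le> 1 \<Longrightarrow> y + e \<le> ((1 + y) / q - 1) ^ d"
proof -
  define g where "g y = ((1 + y) / q - 1) ^ d - y" for y
  have pos: "g y > 0" if "y \<ge> 0" for y
  proof -
    define t where "t = root d y"
    have t: "t \<ge> 0" "t ^ d = y" using that assms(1) by (auto simp: t_def real_root_pow_pos2)
    have "q * (1 + t) < vartheta d * (1 + t)" using t assms by (intro mult_strict_right_mono) auto
    also have "\<dots> \<le> 1 + y" using one_plus_power_ge[OF assms(1) t(1)] t by simp
    finally have "t < (1 + y) / q - 1" using assms by (simp add: field_simps)
    then have "t ^ d < ((1 + y) / q - 1) ^ d" using t assms by (intro power_strict_mono) auto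
    then show ?thesis using t by (simp add: g_def)
  qed
  have "continuous_on {0..1} g" unfolding g_def using assms by (auto intro!: continuous_intros)
  then obtain x where x: "x \<in> {0..1}" "\<And>y. y \<in> {0..1} \<Longrightarrow> g x \<le> g y"
    using continuous_attains_inf[of "{0..1::real}" g] by auto
  show ?thesis
  proof (rule that[of "g x"])
    show "g x > 0" using pos x by auto
    show "y + g x \<le> ((1 + y) / q - 1) ^ d" if "0 \<le> y" "y \<le> 1" for y
      using x(2)[of y] that by (simp add: g_def)
  qed
qed

text \<open>Within \<open>[0, 1]\<close> the negated orbit gains at least \<open>e\<close> per step,
  so \<open>k\<close> steps with \<open>k * e > 1\<close> drive it out. This \<open>k\<close>
  depends on \<open>d\<close> and \<open>q\<close> only, not on the sequence.\<close>

lemma zero_notin_Eset_if_lt: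
  assumes "d \<ge> 2" "odd d" "q < vartheta d"
  obtains k :: nat
  where "\<And>p. unit_params p \<Longrightarrow> (\<And>r. r \<le> k \<Longrightarrow> p (Suc r) < q) \<Longrightarrow> 0 \<notin> Eset d p"
proof (cases "q > 0")
  \<comment> \<open>No positive parameter lies below such a \<open>q\<close>, so the claim is
    vacuous.\<close>
  case False
  then show ?thesis
    using that[of 0] unit_paramsD by (metis One_nat_def le_refl less_le_not_le not_less order_less_trans)
next
  case True
  obtain e where e: "e > 0" "\<And>y. 0 \<le> y \<Longrightarrow> y \<le> 1 \<Longrightarrow> y + e \<le> ((1 + y) / q - 1) ^ d"
    using escape_step[OF assms(1) True assms(3)] by metis
  obtain k :: nat where k: "k * e > 1" using e(1) ex_less_of_nat_mult by blast
  show ?thesis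
  proof (rule that[of k], rule notI)
    fix p assume p: "unit_params p" "\<And>r. r \<le> k \<Longrightarrow> p (Suc r) < q" "0 \<in> Eset d p"
    have le1: "- real_orbit d p j 0 \<le> 1" for j
      using p(3) nonpos_in_Eset_iff[OF p(1) assms(1,2), of 0] by (simp add: minus_le_iff)
    have ge0: "0 \<le> - real_orbit d p j 0" for j
      using real_orbit_nonpos[OF p(1) assms(2), of 0 j] by simp
    have "j * e \<le> - real_orbit d p j 0" if "j \<le> k" for j
      using that
    proof (induction j)
      case (Suc j)
      define y where "y = - real_orbit d p j 0"
      have pj: "0 < p (Suc j)" "p (Suc j) < q"
        using unit_paramsD[OF p(1), of "Suc j"] p(2)[of j] Suc.prems by auto
      have y: "0 \<le> y" "y \<le> 1" using le1 ge0 by (auto simp: y_def)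
      have "Suc j * e \<le> y + e" using Suc by (simp add: y_def algebra_simps)
      also have "\<dots> \<le> ((1 + y) / q - 1) ^ d" by (rule e(2)[OF y])
      also have "\<dots> \<le> ((1 + y) / p (Suc j) - 1) ^ d"
      proof -
        have "(1 + y) / q \<le> (1 + y) / p (Suc j)" using y pj by (intro divide_left_mono) auto
        moreover have "odd d" by fact
        ultimately show ?thesis by (intro power_mono_odd) auto
      qed
      also have "\<dots> = - real_orbit d p (Suc j) 0"
        using real_orbit_Suc_neg[OF assms(2), of p j 0] pj by (simp add: y_def)
      finally show ?case .
    qed auto
    then have "k * e \<le> - real_orbit d p k 0" by simp
    then show False using k le1[of k] by simp
  qed
qed

section \<open>Random sequences\<close>

context prob_space
begin

text \<open>Disjoint blocks of length \<open>k + 1\<close> are independent, and each lies entirely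
  below \<open>q\<close> with probability \<open>c ^ Suc k > 0\<close>. So \<open>L\<close>
  consecutive blocks all fail with probability \<open>(1 - c ^ Suc k) ^ L\<close>, which tends to
  0.\<close>

lemma AE_infinitely_many_runs:
  fixes X :: "nat \<Rightarrow> 'a \<Rightarrow> real"
  assumes indep: "indep_vars (\<lambda>_. borel) X {1..}"
    and prob: "\<And>i. i \<ge> 1 \<Longrightarrow> prob {\<omega> \<in> space M. X i \<omega> < q} = c" and c: "c > 0"
  shows "AE \<omega> in M. \<forall>N. \<exists>n\<ge>N. \<forall>r\<le>k. X (n + Suc r) \<omega> < q"
proof -
  \<comment> \<open>The blocks partition the indices from 1 on; index 0 is left out.\<close>
  define K where "K n = {n * Suc k + 1..n * Suc k + Suc k}" for n
  define B where "B n = {\<omega> \<in> space M. \<forall>i\<in>K n. X i \<omega> < q}" for n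
  have rv: "X i \<in> borel_measurable M" if "i \<ge> 1" for i
    using indep that by (auto simp: indep_vars_def)
  have K: "finite (K n)" "K n \<noteq> {}" "K n \<subseteq> {1..}" "card (K n) = Suc k" for n
    by (auto simp: K_def)
  have disj: "disjoint_family_on K UNIV"
  proof -
    have "m = n" if "i \<in> K m" "i \<in> K n" for i m n
    proof -
      have "(i - 1) div Suc k = n" if "i \<in> K n" for n
        using that by (intro div_nat_eqI) (auto simp: K_def algebra_simps)
      then show ?thesis using that by metis
    qed
    then show ?thesis by (auto simp: disjoint_family_on_def)
  qed
  have B: "B n \<in> events" for n
  proof -
    have "{\<omega> \<in> space M. X i \<omega> < q} \<in> events" if "i \<in> K n" for i
    proof -
      have [measurable]: "X i \<in> borel_measurable M" using rv that K(3)[of n] by auto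
      show ?thesis by measurable
    qed
    then show ?thesis unfolding B_def using K by (intro sets.sets_Collect_finite_All) auto
  qed
  have prob_B: "prob (B n) = c ^ Suc k" for n
  proof -
    have "prob (\<Inter>i\<in>K n. X i -` {..<q} \<inter> space M) = (\<Prod>i\<in>K n. prob (X i -` {..<q} \<inter> space M))"
      using K by (intro indep_varsD[OF indep]) auto
    also have "\<dots> = (\<Prod>i\<in>K n. c)"
    proof (rule prod.cong)
      fix i assume "i \<in> K n"
      then have "prob {\<omega> \<in> space M. X i \<omega> < q} = c" using K(3)[of n] by (intro prob) auto
      moreover have "X i -` {..<q} \<inter> space M = {\<omega> \<in> space M. X i \<omega> < q}" by auto
      ultimately show "prob (X i -` {..<q} \<inter> space M) = c" by simp
    qed simp
    also have "(\<Inter>i\<in>K n. X i -` {..<q} \<inter> space M) = B n"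
      using K(2)[of n] by (auto simp: B_def)
    finally show ?thesis using K(4)[of n] by simp
  qed
  define Y where "Y n \<omega> = restrict (\<lambda>i. X i \<omega>) (K n)" for n \<omega>
  have indep_Y: "indep_vars (\<lambda>n. PiM (K n) (\<lambda>_. borel)) Y UNIV"
    unfolding Y_def[abs_def] using K(3) disj by (intro indep_vars_restrict[OF indep]) auto
  define A where "A n = space (PiM (K n) (\<lambda>_. borel :: real measure)) - PiE (K n) (\<lambda>_. {..<q})" for n
  have A: "A n \<in> sets (PiM (K n) (\<lambda>_. borel))" for n
    unfolding A_def using K by (intro sets.compl_sets sets_PiM_I_finite) auto
  have YA: "Y n -` A n \<inter> space M = space M - B n" for n
    by (auto simp: Y_def A_def B_def space_PiM PiE_iff)
  \<comment> \<open>An empty intersection would be \<open>UNIV\<close> instead of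
    \<open>space M\<close>, hence \<open>L > 0\<close>.\<close>
  have prob_none: "prob (\<Inter>n\<in>{N..<N + L}. space M - B n) = (1 - c ^ Suc k) ^ L" if "L > 0" for N L
  proof -
    have "prob (\<Inter>n\<in>{N..<N + L}. Y n -` A n \<inter> space M)
        = (\<Prod>n\<in>{N..<N + L}. prob (Y n -` A n \<inter> space M))"
      using that A by (intro indep_varsD[OF indep_Y]) auto
    also have "\<dots> = (1 - c ^ Suc k) ^ L"
      unfolding YA using B by (simp add: prob_compl prob_B)
    finally show ?thesis unfolding YA .
  qed
  have c1: "0 < c ^ Suc k" "c ^ Suc k \<le> 1"
    using c prob_B[of 0] prob_le_1[of "B 0"] by auto
  have null: "prob (\<Inter>n\<in>{N..}. space M - B n) = 0" for N
  proof (rule antisym)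
    have "(\<lambda>L. (1 - c ^ Suc k) ^ Suc L) \<longlonglongrightarrow> 0"
      using c1 by (intro LIMSEQ_Suc LIMSEQ_realpow_zero) auto
    moreover have "prob (\<Inter>n\<in>{N..}. space M - B n) \<le> (1 - c ^ Suc k) ^ Suc L" for L
    proof -
      have "(\<Inter>n\<in>{N..<N + Suc L}. space M - B n) \<in> events"
        using B by (intro sets.finite_INT) auto
      then have "prob (\<Inter>n\<in>{N..}. space M - B n) \<le> prob (\<Inter>n\<in>{N..<N + Suc L}. space M - B n)"
        by (intro finite_measure_mono) auto
      then show ?thesis using prob_none[of "Suc L" N] by simp
    qed
    ultimately show "prob (\<Inter>n\<in>{N..}. space M - B n) \<le> 0"
      by (intro LIMSEQ_le_const) auto
  qed simp
  have "AE \<omega> in M. \<exists>n\<ge>N. \<omega> \<in> B n" for N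
  proof -
    have ev: "(\<Inter>n\<in>{N..}. space M - B n) \<in> events"
      using B by (intro sets.countable_INT') auto
    then have "AE \<omega> in M. \<omega> \<notin> (\<Inter>n\<in>{N..}. space M - B n)"
      using null[of N] AE_iff_measurable[OF ev, of "\<lambda>\<omega>. \<omega> \<notin> (\<Inter>n\<in>{N..}. space M - B n)"]
        sets.sets_into_space[OF ev] by (auto simp: emeasure_eq_measure)
    then show ?thesis using AE_space by eventually_elim auto
  qed
  then have "AE \<omega> in M. \<forall>N. \<exists>n\<ge>N. \<omega> \<in> B n" by (simp add: AE_all_countable)
  then show ?thesis
  proof eventually_elim
    case (elim \<omega>)
    show ?case
    proof
      fix N
      obtain n where n: "n \<ge> N" "\<omega> \<in> B n" using elim by blast
      have "X (n * Suc k + Suc r) \<omega> < q" if "r \<le> k" for r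
        using n(2) that by (auto simp: B_def K_def)
      moreover have "N \<le> n * Suc k" using n(1) by (simp add: trans_le_add1)
      ultimately show "\<exists>n\<ge>N. \<forall>r\<le>k. X (n + Suc r) \<omega> < q" by blast
    qed
  qed
qed

lemma prob_infinite_components_Eset:
  fixes p :: "nat \<Rightarrow> 'a \<Rightarrow> real"
  assumes d: "d \<ge> 2" "odd d"
    and unit: "\<And>i \<omega>. i \<ge> 1 \<Longrightarrow> \<omega> \<in> space M \<Longrightarrow> 0 < p i \<omega> \<and> p i \<omega> \<le> 1"
    and indep: "indep_vars (\<lambda>_. borel) p {1..}"
    and ident: "\<And>i j. i \<ge> 1 \<Longrightarrow> j \<ge> 1 \<Longrightarrow> distr M borel (p i) = distr M borel (p j)"
    and pos: "prob {\<omega> \<in> space M. p 1 \<omega> < vartheta d} > 0"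
  shows "prob {\<omega> \<in> space M. infinite (components (Eset d (\<lambda>i. p i \<omega>)))} = 1"
proof -
  define P where "P \<omega> = (\<lambda>i. p i \<omega>)" for \<omega>
  have unitP: "unit_params (P \<omega>)" if "\<omega> \<in> space M" for \<omega>
    using unit that by (auto simp: unit_params_def P_def)
  have rv: "p i \<in> borel_measurable M" if "i \<ge> 1" for i
    using indep that by (auto simp: indep_vars_def)
  have rv1 [measurable]: "p 1 \<in> borel_measurable M" by (rule rv) simp
  have orbit: "(\<lambda>\<omega>. real_orbit d (param_shift k (P \<omega>)) j 0) \<in> borel_measurable M" for k j
  proof (induction j)
    case (Suc j)
    have "p (Suc (j + k)) \<in> borel_measurable M" by (rule rv) simp
    then show ?case using Suc by (auto simp: param_shift_def P_def)
  qed simp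
  have zero_iff: "0 \<in> Eset d (param_shift k (P \<omega>))
      \<longleftrightarrow> (\<forall>j. real_orbit d (param_shift k (P \<omega>)) j 0 \<ge> -1)" if "\<omega> \<in> space M" for k \<omega>
    using nonpos_in_Eset_iff[OF unit_params_shift[OF unitP[OF that]] d, where x = 0] by simp
  \<comment> \<open>The right-hand side is a countable combination of conditions on measurable
    orbits, so the event is measurable.\<close>
  have iff: "infinite (components (Eset d (P \<omega>)))
      \<longleftrightarrow> (\<forall>k\<ge>1. \<not> (\<forall>j. real_orbit d (param_shift k (P \<omega>)) j 0 \<ge> -1))" if "\<omega> \<in> space M" for \<omega>
    using infinite_components_Eset_iff[OF unitP[OF that] d] zero_iff[OF that] by simp
  have "{\<omega> \<in> space M. infinite (components (Eset d (P \<omega>)))} =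
    {\<omega> \<in> space M. \<forall>k\<ge>1. \<not> (\<forall>j. real_orbit d (param_shift k (P \<omega>)) j 0 \<ge> -1)}"
    using iff by blast
  also have "\<dots> \<in> events"
    using orbit by measurable
  finally have event: "{\<omega> \<in> space M. infinite (components (Eset d (P \<omega>)))} \<in> events" .
  \<comment> \<open>Escape within a uniform number of steps needs a fixed gap below
    \<open>vartheta d\<close>; continuity from below of the measure supplies it with positive
    probability.\<close>
  obtain q where q: "q < vartheta d" "prob {\<omega> \<in> space M. p 1 \<omega> < q} > 0"
  proof -
    define A where "A n = {\<omega> \<in> space M. p 1 \<omega> < vartheta d - inverse (real (Suc n))}" for n
    have "A n \<in> events" for n unfolding A_def by measurable
    then have meas: "range A \<subseteq> events" by blast
    have "incseq A"
      by (intro incseq_SucI) (auto simp: A_def intro: less_le_trans le_imp_inverse_le)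
    then have "(\<lambda>n. prob (A n)) \<longlonglongrightarrow> prob (\<Union>n. A n)"
      using meas by (rule finite_Lim_measure_incseq[rotated])
    moreover have "(\<Union>n. A n) = {\<omega> \<in> space M. p 1 \<omega> < vartheta d}"
    proof -
      have "\<exists>n. x < vartheta d - inverse (real (Suc n))" if "x < vartheta d" for x
        using reals_Archimedean[of "vartheta d - x"] that by (auto simp: algebra_simps)
      moreover have "x < vartheta d" if "x < vartheta d - inverse (real (Suc n))" for x n
        using that by (smt (verit) inverse_nonnegative_iff_nonnegative of_nat_0_le_iff)
      ultimately show ?thesis by (auto simp: A_def)
    qed
    ultimately have "\<forall>\<^sub>F n in sequentially. prob (A n) > 0"
      using pos by (intro order_tendstoD) auto
    then obtain n where "prob (A n) > 0" using eventually_sequentially by auto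
    then show ?thesis using that[of "vartheta d - inverse (real (Suc n))"] by (simp add: A_def)
  qed
  have same: "prob {\<omega> \<in> space M. p i \<omega> < q} = prob {\<omega> \<in> space M. p 1 \<omega> < q}" if "i \<ge> 1" for i
  proof -
    have "prob {\<omega> \<in> space M. p j \<omega> < q} = measure (distr M borel (p j)) {..<q}" if "j \<ge> 1" for j
      using rv[OF that] by (subst measure_distr) (auto intro!: arg_cong[where f = prob])
    then show ?thesis using that ident[of i 1] by simp
  qed
  obtain k where k: "\<And>p. unit_params p \<Longrightarrow> (\<And>r. r \<le> k \<Longrightarrow> p (Suc r) < q) \<Longrightarrow> 0 \<notin> Eset d p"
    using zero_notin_Eset_if_lt[OF d q(1)] by metis
  have "AE \<omega> in M. \<forall>N. \<exists>n\<ge>N. \<forall>r\<le>k. p (n + Suc r) \<omega> < q"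
    by (rule AE_infinitely_many_runs[OF indep same q(2)])
  moreover have "AE \<omega> in M. \<omega> \<in> space M" by simp
  ultimately have "AE \<omega> in M. \<omega> \<in> {\<omega> \<in> space M. infinite (components (Eset d (P \<omega>)))}"
  proof eventually_elim
    case (elim \<omega>)
    \<comment> \<open>A run of small parameters beyond index \<open>m\<close> excludes 0 at some
      later shift, and persistence carries this back to \<open>m\<close>.\<close>
    have "0 \<notin> Eset d (param_shift m (P \<omega>))" for m
    proof -
      obtain n where n: "n \<ge> m" "\<And>r. r \<le> k \<Longrightarrow> p (n + Suc r) \<omega> < q" using elim(1) by blast
      have "0 \<notin> Eset d (param_shift n (P \<omega>))"
        using n(2) by (intro k unit_params_shift unitP elim) (simp add: param_shift_def P_def add.commute)
      then show ?thesis
        using zero_in_Eset_shift_mono[OF unitP[OF elim(2)] d n(1)] by blast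
    qed
    then show ?case using infinite_components_Eset_iff[OF unitP[OF elim(2)] d] elim(2) by simp
  qed
  then show ?thesis using prob_eq_1[OF event] by (simp add: P_def)
qed

end

section \<open>Assembly of the six claims\<close>

theorem proposition4p6:
  fixes d :: nat
  assumes "d \<ge> 3" and "odd d"
  shows
    "(\<forall>p. admissible p \<longrightarrow>
        (connected (Eset d p) \<longleftrightarrow> complex_of_real (1 - p 1) \<in> Eset d p))
   \<and> (\<forall>p. admissible p \<longrightarrow> (\<forall>j\<ge>2. p j \<ge> vartheta d) \<longrightarrow> connected (Eset d p))
   \<and> (\<forall>\<delta>. 0 < \<delta> \<and> \<delta> < vartheta d \<longrightarrow>
        (\<exists>k::nat. \<forall>p. admissible p \<longrightarrow>
           (\<exists>m\<ge>2. \<forall>r\<le>k. p (m + r) < vartheta d - \<delta>) \<longrightarrow> \<not> connected (Eset d p)))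
   \<and> (\<forall>p. admissible p \<longrightarrow>
        (\<forall>j\<ge>1. p j < 1 / 2 \<longrightarrow>
           infinite (components (Eset d p)) \<or> d ^ (j - 1) \<le> card (components (Eset d p))))
   \<and> (\<forall>p. admissible p \<longrightarrow> infinite {j. 1 \<le> j \<and> p j < 1 / 2} \<longrightarrow>
        infinite (components (Eset d p)))
   \<and> (\<forall>(M :: 'a measure) (p :: nat \<Rightarrow> 'a \<Rightarrow> real).
        prob_space M \<longrightarrow>
        (\<forall>i\<ge>1. \<forall>\<omega>\<in>space M. 0 < p i \<omega> \<and> p i \<omega> \<le> 1) \<longrightarrow>
        prob_space.indep_vars M (\<lambda>_. borel) p {1..} \<longrightarrow>
        (\<forall>i\<ge>1. \<forall>j\<ge>1. distr M borel (p i) = distr M borel (p j)) \<longrightarrow>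
        (\<forall>i\<ge>1. measure M {\<omega> \<in> space M. p i \<omega> < vartheta d} > 0) \<longrightarrow>
        measure M {\<omega> \<in> space M. infinite (components (Eset d (\<lambda>i. p i \<omega>)))} = 1)"
proof (intro conjI allI impI)
  have d: "d \<ge> 2" "odd d" using assms by auto
  fix p assume "admissible p"
  then have p: "unit_params p" by (rule admissible_unit_params)
  show "connected (Eset d p) \<longleftrightarrow> complex_of_real (1 - p 1) \<in> Eset d p"
  proof -
    \<comment> \<open>The point \<open>1 - p 1\<close> is the critical point of the first step, so
      its boundedness is that of 0 for shift 1.\<close>
    have "ftilde d p 1 (complex_of_real (1 - p 1)) = 0" using d by (simp add: fstep_def)
    then show ?thesis
      using connected_Eset_iff[OF p d] Eset_shift[of "complex_of_real (1 - p 1)" d p 1] by metis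
  qed
  show "connected (Eset d p)" if "\<forall>j\<ge>2. p j \<ge> vartheta d"
    using that unfolding connected_Eset_iff[OF p d]
    by (intro zero_in_Eset_if_ge_vartheta unit_params_shift p d) (auto simp: param_shift_def)
  \<comment> \<open>Here \<open>p j < 1 / 2\<close> excludes 0 for the shifts \<open>1\<close> to
    \<open>j - 1\<close>, which yields the exponent \<open>j - 1\<close>. Exponent \<open>j\<close>
    would fail: if \<open>j = 1\<close> and all later parameters are at least
    \<open>vartheta d\<close>, the set is connected.\<close>
  show "infinite (components (Eset d p)) \<or> d ^ (j - 1) \<le> card (components (Eset d p))"
    if "1 \<le> j" "p j < 1 / 2" for j
    using zero_notin_Eset_shift_if_lt_half[OF p d that(2)] that(1)
      components_Eset_lower_bound[OF p d, of "j - 1"] by fastforce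
  show "infinite (components (Eset d p))" if inf: "infinite {j. 1 \<le> j \<and> p j < 1 / 2}"
  proof -
    have "0 \<notin> Eset d (param_shift i p)" for i
    proof -
      obtain j where "j > i" "p j < 1 / 2"
        using inf by (auto simp: infinite_nat_iff_unbounded)
      then show ?thesis using zero_notin_Eset_shift_if_lt_half[OF p d] by blast
    qed
    then show ?thesis using infinite_components_Eset_iff[OF p d] by blast
  qed
next
  fix \<delta> assume "0 < \<delta> \<and> \<delta> < vartheta d"
  then have q: "vartheta d - \<delta> < vartheta d" by simp
  have d: "d \<ge> 2" "odd d" using assms by auto
  obtain k where k: "\<And>p. unit_params p \<Longrightarrow> (\<And>r. r \<le> k \<Longrightarrow> p (Suc r) < vartheta d - \<delta>)
      \<Longrightarrow> 0 \<notin> Eset d p"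
    using zero_notin_Eset_if_lt[OF d q] by metis
  show "\<exists>k::nat. \<forall>p. admissible p \<longrightarrow>
      (\<exists>m\<ge>2. \<forall>r\<le>k. p (m + r) < vartheta d - \<delta>) \<longrightarrow> \<not> connected (Eset d p)"
  proof (intro exI[of _ k] allI impI)
    fix p assume "admissible p" "\<exists>m\<ge>2. \<forall>r\<le>k. p (m + r) < vartheta d - \<delta>"
    then obtain m where p: "unit_params p" and m: "m \<ge> 2" "\<And>r. r \<le> k \<Longrightarrow> p (m + r) < vartheta d - \<delta>"
      using admissible_unit_params by blast
    \<comment> \<open>Shift \<open>m - 1\<close> puts the run starting at \<open>m\<close> at index
      1; as \<open>m \<ge> 2\<close>, the shift is at least 1.\<close>
    have "0 \<notin> Eset d (param_shift (m - 1) p)"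
      using m by (intro k unit_params_shift p) (simp add: param_shift_def add.commute)
    moreover have "1 \<le> m - 1" using m(1) by simp
    ultimately show "\<not> connected (Eset d p)"
      using zero_in_Eset_shift_mono[OF p d] connected_Eset_iff[OF p d] by metis
  qed
next
  fix M :: "'a measure" and p :: "nat \<Rightarrow> 'a \<Rightarrow> real"
  assume *: "prob_space M" "\<forall>i\<ge>1. \<forall>\<omega>\<in>space M. 0 < p i \<omega> \<and> p i \<omega> \<le> 1"
    "prob_space.indep_vars M (\<lambda>_. borel) p {1..}"
    "\<forall>i\<ge>1. \<forall>j\<ge>1. distr M borel (p i) = distr M borel (p j)"
    "\<forall>i\<ge>1. measure M {\<omega> \<in> space M. p i \<omega> < vartheta d} > 0"
  interpret prob_space M by fact
  show "measure M {\<omega> \<in> space M. infinite (components (Eset d (\<lambda>i. p i \<omega>)))} = 1"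
  proof (rule prob_infinite_components_Eset)
    show "d \<ge> 2" "odd d" using assms by auto
    show "indep_vars (\<lambda>_. borel) p {1..}" by fact
    show "0 < p i \<omega> \<and> p i \<omega> \<le> 1" if "i \<ge> 1" "\<omega> \<in> space M" for i \<omega>
      using *(2) that by blast
    show "distr M borel (p i) = distr M borel (p j)" if "i \<ge> 1" "j \<ge> 1" for i j
      using *(4) that by blast
    show "prob {\<omega> \<in> space M. p 1 \<omega> < vartheta d} > 0" using *(5) by blast
  qed
qed

end
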